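(* Let $X_\infty=\varprojlim\{I,f_i\}$, where $I=[0,1]$ and each $f_i:I\to I$ ($i\in\mathbb{N}$) is a continuous piecewise linear surjection which does not have zigzags. Then for every $x\in X_\infty$ there exists an embedding $\phi$ of $X_\infty$ in the plane $\mathbb{R}^2$ such that $\phi(x)$ is an accessible point of $\phi(X_\infty)$.
   Context: $\mathbb{N}=\{1,2,3,\dots\}$, $\mathbb{N}_0=\{0,1,2,\dots\}$. Inverse limit: $\varprojlim\{I,f_i\}=\{(x_0,x_1,x_2,\dots)\in I^{\mathbb{N}_0}: f_i(x_i)=x_{i-1},\ i\in\mathbb{N}\}$ with the subspace topology from the product topology. Piecewise linear maps have finitely many critical points $0=t_0<t_1<\dots<t_m<t_{m+1}=1$ (the endpoints $0,1$ are included among the critical points; the others are the turning points, so $f$ is monotone on each $[t_k,t_{k+1}]$). Zigzag: let $f:I\to I$ be a continuous piecewise monotone surjection with critical points $0=t_0<\dots<t_{m+1}=1$ and put $I_k=[t_k,t_{k+1}]$. $I_k$ is inside a zigzag of $f$ if there exist critical points $a,e$ of $f$ with $a<t_k<t_{k+1}<e$ such that either (1) $f(t_k)>f(t_{k+1})$ and $f|_{[a,e]}$ assumes its global minimum at $a$ and its global maximum at $e$, or (2) $f(t_k)<f(t_{k+1})$ and $f|_{[a,e]}$ assumes its global maximum at $a$ and its global minimum at $e$. In that case every $x\in I_k\setminus\{t_k,t_{k+1}\}$ is said to be inside a zigzag of $f$. The map $f$ has (contains) a zigzag if there is a point inside a zigzag of $f$. A point $y$ of $Y\subset\mathbb{R}^2$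 is accessible (from the complement of $Y$) if there is an arc $A\subset\mathbb{R}^2$ with $A\cap Y=\{y\}$. *)

theory Defs
  imports "HOL-Analysis.Analysis"
begin

text \<open>Self-maps of the unit interval are represented by functions of type
  \<^typ>\<open>real \<Rightarrow> real\<close>; everything below depends only on their values on \<open>{0..1}\<close>.\<close>

definition piecewise_linear :: "(real \<Rightarrow> real) \<Rightarrow> bool" where
  "piecewise_linear f \<longleftrightarrow>
     (\<exists>(n::nat) (s::nat \<Rightarrow> real). s 0 = 0 \<and> s (Suc n) = 1 \<and>
        (\<forall>k\<le>n. s k < s (Suc k) \<and> (\<exists>c d. \<forall>x\<in>{s k..s (Suc k)}. f x = c * x + d)))"

text \<open>If \<open>f\<close> has no flat pieces, the turning points below are exactly the points where \<open>f\<close>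
  changes between increasing and decreasing. Piecewise linear maps may have flat
  pieces; the end points of those pieces are counted as well, so that in every case there are
  only finitely many critical points and \<open>f\<close> is monotone between consecutive ones.\<close>

definition turning_point :: "(real \<Rightarrow> real) \<Rightarrow> real \<Rightarrow> bool" where
  "turning_point f t \<longleftrightarrow> 0 < t \<and> t < 1 \<and>
     \<not> (\<exists>\<epsilon>>0. let U = ball t \<epsilon> \<inter> {0..1} in
           strict_mono_on U f \<or> strict_antimono_on U f \<or> f constant_on U)"

definition critical_points :: "(real \<Rightarrow> real) \<Rightarrow> real set" where
  "critical_points f = {0, 1} \<union> {t. turning_point f t}"

text \<open>The intervals \<open>I\<^sub>k = [t\<^sub>k, t\<^sub>k\<^sub>+\<^sub>1]\<close> are the \<open>{s..t}\<close> with \<open>s\<close>, \<open>t\<close> consecutive.\<close>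

definition consecutive_critical :: "(real \<Rightarrow> real) \<Rightarrow> real \<Rightarrow> real \<Rightarrow> bool" where
  "consecutive_critical f s t \<longleftrightarrow>
     s \<in> critical_points f \<and> t \<in> critical_points f \<and> s < t \<and>
     critical_points f \<inter> {s<..<t} = {}"

definition interval_inside_zigzag :: "(real \<Rightarrow> real) \<Rightarrow> real \<Rightarrow> real \<Rightarrow> bool" where
  "interval_inside_zigzag f s t \<longleftrightarrow>
     consecutive_critical f s t \<and>
     (\<exists>a\<in>critical_points f. \<exists>e\<in>critical_points f. a < s \<and> t < e \<and>
        ((f s > f t \<and> (\<forall>x\<in>{a..e}. f a \<le> f x \<and> f x \<le> f e)) \<or>
         (f s < f t \<and> (\<forall>x\<in>{a..e}. f e \<le> f x \<and> f x \<le> f a))))"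

definition inside_zigzag :: "(real \<Rightarrow> real) \<Rightarrow> real \<Rightarrow> bool" where
  "inside_zigzag f x \<longleftrightarrow> (\<exists>s t. interval_inside_zigzag f s t \<and> x \<in> {s<..<t})"

definition has_zigzag :: "(real \<Rightarrow> real) \<Rightarrow> bool" where
  "has_zigzag f \<longleftrightarrow> (\<exists>x. inside_zigzag f x)"

text \<open>The bonding maps are \<open>f 1, f 2, \<dots>\<close>; the value \<open>f 0\<close> is not used.\<close>

definition inverse_limit :: "(nat \<Rightarrow> real \<Rightarrow> real) \<Rightarrow> (nat \<Rightarrow> real) set" where
  "inverse_limit f = {x. (\<forall>i. x i \<in> {0..1}) \<and> (\<forall>i\<ge>1. f i (x i) = x (i - 1))}"

definition inverse_limit_topology :: "(nat \<Rightarrow> real \<Rightarrow> real) \<Rightarrow> (nat \<Rightarrow> real) topology" where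
  "inverse_limit_topology f =
     subtopology (product_topology (\<lambda>_. top_of_set {0..1}) UNIV) (inverse_limit f)"

definition accessible_point :: "(real^2) set \<Rightarrow> real^2 \<Rightarrow> bool" where
  "accessible_point Y y \<longleftrightarrow> y \<in> Y \<and> (\<exists>g. arc g \<and> path_image g \<inter> Y = {y})"

end

theory Submission
  imports Defs
begin

text \<open>Attach an arc to \<open>X\<^sub>\<infinity>\<close> at \<open>x\<close>. The result is the inverse limit of the triods
  \<open>T\<^sub>n = I \<times> {0} \<union> {x\<^sub>n} \<times> [0, 1]\<close> with bonding maps induced by \<open>f\<^sub>n \<times> id\<close>, and any plane
  embedding of it makes \<open>x\<close> accessible. By the argument of Anderson and Choquet such an embedding
  exists as soon as each \<open>f\<^sub>n \<times> id\<close> on \<open>T\<^sub>n\<close> can be approximated uniformly by injective continuous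
  maps of the whole plane: compose approximations whose errors decrease fast enough.

  A map without zigzags is monotone between a global minimum and a global maximum of its restriction
  to any interval. Hence, up to reflecting \<open>I\<close> and the values, \<open>f\<close> is nondecreasing on some
  \<open>[x, b]\<close> and at most \<open>f b\<close> on \<open>[0, b]\<close>. One can then draw \<open>f|[0, b]\<close> as a thin graph with \<open>x\<close>
  on top, turn around to the right of everything drawn so far, and draw \<open>f|[b, 1]\<close> below it.\<close>

section \<open>Maps without zigzags\<close>

definition increasing_at :: "(real \<Rightarrow> real) \<Rightarrow> real \<Rightarrow> bool" where
  "increasing_at f r \<longleftrightarrow> (\<exists>\<epsilon>>0. strict_mono_on (ball r \<epsilon> \<inter> {0..1}) f)"

lemma strict_mono_on_uminus:
  fixes f :: "real \<Rightarrow> real"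
  shows "strict_mono_on U (\<lambda>t. - f t) \<longleftrightarrow> strict_antimono_on U f"
    and "strict_antimono_on U (\<lambda>t. - f t) \<longleftrightarrow> strict_mono_on U f"
    and "(\<lambda>t. - f t) constant_on U \<longleftrightarrow> f constant_on U"
  by (auto simp: monotone_on_def constant_on_def) (metis minus_minus)

lemma critical_points_uminus: "critical_points (\<lambda>t. - f t) = critical_points f"
  by (auto simp: critical_points_def turning_point_def Let_def strict_mono_on_uminus)

text \<open>Negation exchanges the two kinds of zigzag. Descents are treated throughout as ascents
  of \<open>- f\<close>.\<close>

lemma has_zigzag_uminus: "has_zigzag (\<lambda>t. - f t) \<longleftrightarrow> has_zigzag f"
  unfolding has_zigzag_def inside_zigzag_def interval_inside_zigzag_def
    consecutive_critical_def critical_points_uminus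
  by (intro ex_cong1 conj_cong refl bex_cong) auto

lemma regular_point_cases:
  assumes "r \<in> {0..1}" "r \<notin> critical_points f"
  shows "increasing_at f r \<or> increasing_at (\<lambda>t. - f t) r \<or>
         (\<exists>\<epsilon>>0. f constant_on (ball r \<epsilon> \<inter> {0..1}))"
  using assms unfolding critical_points_def turning_point_def increasing_at_def Let_def
    strict_mono_on_uminus
  by fastforce

lemma increasing_at_right:
  assumes "increasing_at f r" "r \<in> {0..1}" "r < e" "e \<le> 1"
  shows "\<exists>u. r < u \<and> u < e \<and> f r < f u"
proof -
  obtain \<epsilon> where \<epsilon>: "\<epsilon> > 0" "strict_mono_on (ball r \<epsilon> \<inter> {0..1}) f"
    using assms(1) by (auto simp: increasing_at_def)
  define u where "u = r + min (\<epsilon>/2) ((e - r)/2)"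
  have "r < u" "u < e" "u \<in> ball r \<epsilon>"
    using \<epsilon>(1) assms by (auto simp: u_def dist_real_def min_def field_simps)
  then show ?thesis
    using \<epsilon> assms by (intro exI[of _ u]) (auto simp: monotone_on_def)
qed

lemma increasing_at_left:
  assumes "increasing_at f r" "r \<in> {0..1}" "e < r" "0 \<le> e"
  shows "\<exists>u. e < u \<and> u < r \<and> f u < f r"
proof -
  obtain \<epsilon> where \<epsilon>: "\<epsilon> > 0" "strict_mono_on (ball r \<epsilon> \<inter> {0..1}) f"
    using assms(1) by (auto simp: increasing_at_def)
  define u where "u = r - min (\<epsilon>/2) ((r - e)/2)"
  have "u < r" "e < u" "u \<in> ball r \<epsilon>"
    using \<epsilon>(1) assms by (auto simp: u_def dist_real_def min_def field_simps)
  then show ?thesis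
    using \<epsilon> assms by (intro exI[of _ u]) (auto simp: monotone_on_def)
qed

lemma increasing_at_near:
  assumes "strict_mono_on (ball r \<epsilon> \<inter> {0..1}) f" "v \<in> ball r \<epsilon>"
  shows "increasing_at f v"
proof -
  obtain d where "d > 0" "ball v d \<subseteq> ball r \<epsilon>"
    using assms(2) open_ball openE by blast
  then show ?thesis
    using assms(1) unfolding increasing_at_def
    by (intro exI[of _ d]) (auto intro: monotone_on_subset)
qed

text \<open>Near a regular point \<open>f\<close> is strictly increasing, strictly decreasing or
  constant, and one ascent nearby excludes the last two. So being a point of increase is a locally
  constant property on the open interval, and the interval is connected.\<close>

lemma increasing_at_propagate:
  assumes "0 \<le> s" "t \<le> 1" "critical_points f \<inter> {s<..<t} = {}"
    and "r \<in> {s<..<t}" "increasing_at f r" "u \<in> {s<..<t}"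
  shows "increasing_at f u"
proof (rule connected_induction_simple[of "{s<..<t}" r u "increasing_at f"])
  fix a assume a: "a \<in> {s<..<t}"
  then have "a \<in> {0..1}" "a \<notin> critical_points f" using assms by auto
  from regular_point_cases[OF this] obtain \<epsilon> where \<epsilon>: "\<epsilon> > 0"
    and cases: "strict_mono_on (ball a \<epsilon> \<inter> {0..1}) f \<or>
      strict_mono_on (ball a \<epsilon> \<inter> {0..1}) (\<lambda>t. - f t) \<or> f constant_on (ball a \<epsilon> \<inter> {0..1})"
    unfolding increasing_at_def by blast
  have step: "increasing_at f v \<longrightarrow> increasing_at f w"
    if v: "v \<in> ball a \<epsilon> \<inter> {s<..<t}" and w: "w \<in> ball a \<epsilon> \<inter> {s<..<t}" for v w
  proof
    assume inc: "increasing_at f v"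
    have "min t (a + \<epsilon>) > v" "min t (a + \<epsilon>) \<le> 1"
      using v assms by (auto simp: dist_real_def)
    then obtain v' where v': "v < v'" "v' < min t (a + \<epsilon>)" "f v < f v'"
      using increasing_at_right[OF inc, of "min t (a + \<epsilon>)"] v assms by auto
    have vv': "v \<in> ball a \<epsilon> \<inter> {0..1}" "v' \<in> ball a \<epsilon> \<inter> {0..1}"
      using v v' assms by (auto simp: dist_real_def)
    have "\<not> strict_mono_on (ball a \<epsilon> \<inter> {0..1}) (\<lambda>t. - f t)"
      using strict_mono_onD[OF _ vv' v'(1), of "\<lambda>t. - f t"] v'(3) by auto
    moreover have "\<not> f constant_on (ball a \<epsilon> \<inter> {0..1})"
    proof
      assume "f constant_on (ball a \<epsilon> \<inter> {0..1})"
      then obtain c where "\<forall>x\<in>ball a \<epsilon> \<inter> {0..1}. f x = c" unfolding constant_on_def ..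
      with vv' have "f v = c" "f v' = c" by blast+
      with v'(3) show False by simp
    qed
    ultimately have "strict_mono_on (ball a \<epsilon> \<inter> {0..1}) f"
      using cases by blast
    with w show "increasing_at f w" by (blast intro: increasing_at_near)
  qed
  show "\<exists>T. openin (top_of_set {s<..<t}) T \<and> a \<in> T \<and>
      (\<forall>x\<in>T. \<forall>y\<in>T. increasing_at f x \<longrightarrow> increasing_at f y)"
  proof (intro exI conjI ballI)
    show "openin (top_of_set {s<..<t}) (ball a \<epsilon> \<inter> {s<..<t})"
      by (metis Int_commute open_ball openin_open_Int)
    show "a \<in> ball a \<epsilon> \<inter> {s<..<t}" using a \<epsilon> by simp
  qed (rule step)
qed (use assms in auto)

text \<open>A maximum of \<open>f\<close> on \<open>[u, v]\<close> can only sit at \<open>v\<close>.\<close>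

lemma strict_mono_on_if_increasing_at:
  assumes cont: "continuous_on {s..t} f" and "0 \<le> s" "t \<le> 1"
    and inc: "\<And>u. u \<in> {s<..<t} \<Longrightarrow> increasing_at f u"
  shows "strict_mono_on {s..t} f"
proof -
  have inner: "f u < f v" if uv: "s < u" "u < v" "v \<le> t" for u v
  proof -
    have "continuous_on {u..v} f" by (rule continuous_on_subset[OF cont]) (use uv in auto)
    then obtain w where w: "w \<in> {u..v}" "\<And>y. y \<in> {u..v} \<Longrightarrow> f y \<le> f w"
      using continuous_attains_sup[of "{u..v}" f] uv by auto
    have last: "z = v" if z: "z \<in> {u..v}" "f z = f w" for z
    proof (rule ccontr)
      assume "z \<noteq> v"
      then obtain y where "z < y" "y < v" "f z < f y"
        using increasing_at_right[OF inc, of z v] z uv assms by auto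
      then show False using w(2)[of y] z by auto
    qed
    show ?thesis using last[of w] last[of u] w uv by fastforce
  qed
  \<comment> \<open>\<open>inner\<close> starts right of \<open>s\<close>, where no local
    information is assumed; continuity gives the weak inequality up to a midpoint, and
    \<open>inner\<close> makes it strict.\<close>
  have "f s < f v" if "s < v" "v \<le> t" for v
  proof -
    define m where "m = (s + v)/2"
    have m: "s < m" "m < v" using that by (auto simp: m_def)
    have "f s \<le> f m"
    proof (rule tendsto_upperbound)
      show "(f \<longlongrightarrow> f s) (at_right s)"
        using cont that by (metis atLeastAtMost_iff at_within_Icc_at_right continuous_on_def
            less_eq_real_def order_less_le_trans)
      show "\<forall>\<^sub>F u in at_right s. f u \<le> f m"
        unfolding eventually_at_right[OF m(1)]
        using inner[of _ m] m that by (intro exI[of _ m]) (auto intro: less_imp_le)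
    qed auto
    then show ?thesis using inner[of m v] m that by linarith
  qed
  then show ?thesis using inner
    unfolding monotone_on_def by (metis atLeastAtMost_iff less_eq_real_def)
qed

text \<open>Adding \<open>\<epsilon> * u\<close> turns flat pieces into ascents, so the strict
  version applies; then \<epsilon> tends to 0.\<close>

lemma mono_on_if_not_decreasing_at:
  assumes cont: "continuous_on {s..t} f" and "0 \<le> s" "t \<le> 1"
    and crit: "critical_points f \<inter> {s<..<t} = {}"
    and nd: "\<And>u. u \<in> {s<..<t} \<Longrightarrow> \<not> increasing_at (\<lambda>t. - f t) u"
  shows "mono_on {s..t} f"
proof -
  have "strict_mono_on {s..t} (\<lambda>u. f u + \<epsilon> * u)" if "\<epsilon> > 0" for \<epsilon>
  proof (rule strict_mono_on_if_increasing_at)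
    show "continuous_on {s..t} (\<lambda>u. f u + \<epsilon> * u)" by (intro continuous_intros cont)
    fix u assume u: "u \<in> {s<..<t}"
    then have "u \<in> {0..1}" "u \<notin> critical_points f" using assms by auto
    from regular_point_cases[OF this] nd[OF u]
    obtain d where "d > 0" and
      "strict_mono_on (ball u d \<inter> {0..1}) f \<or> f constant_on (ball u d \<inter> {0..1})"
      unfolding increasing_at_def by blast
    then have "mono_on (ball u d \<inter> {0..1}) f"
      by (auto simp: constant_on_def strict_mono_on_imp_mono_on intro: mono_onI)
    then have "strict_mono_on (ball u d \<inter> {0..1}) (\<lambda>u. f u + \<epsilon> * u)"
      using that by (auto simp: monotone_on_def intro!: add_le_less_mono)
    with \<open>d > 0\<close> show "increasing_at (\<lambda>u. f u + \<epsilon> * u) u"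
      unfolding increasing_at_def by blast
  qed (use assms in auto)
  then have *: "f u < f v + \<epsilon>" if "u \<in> {s..t}" "v \<in> {s..t}" "u < v" "\<epsilon> > 0" for u v \<epsilon>
  proof -
    have "f u + \<epsilon> * u < f v + \<epsilon> * v"
      using \<open>\<And>\<epsilon>. \<epsilon> > 0 \<Longrightarrow> strict_mono_on {s..t} (\<lambda>u. f u + \<epsilon> * u)\<close>[OF that(4)] that
      by (auto simp: monotone_on_def)
    moreover have "\<epsilon> * v - \<epsilon> * u \<le> \<epsilon> * 1"
      unfolding right_diff_distrib[symmetric]
      using that assms by (intro mult_left_mono) auto
    ultimately show ?thesis by linarith
  qed
  have "f u \<le> f v" if "u \<in> {s..t}" "v \<in> {s..t}" "u < v" for u v
    by (rule field_le_epsilon) (use *[OF that] in \<open>auto intro: less_imp_le\<close>)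
  then show ?thesis by (intro mono_onI) (metis less_eq_real_def)
qed

text \<open>\<open>s\<close> and \<open>t\<close> are the critical points nearest to
  \<open>r\<close> on either side, and the behaviour at \<open>r\<close> spreads over the whole
  branch. The branch may be flat, hence the weak second alternative.\<close>

lemma regular_point_branch:
  assumes fin: "finite (critical_points f)" and cont: "continuous_on {0..1} f"
    and "r \<in> {0..1}" "r \<notin> critical_points f"
  obtains s t where "consecutive_critical f s t" "0 \<le> s" "s < r" "r < t" "t \<le> 1"
    "increasing_at f r \<Longrightarrow> strict_mono_on {s..t} f"
    "\<not> increasing_at (\<lambda>t. - f t) r \<Longrightarrow> mono_on {s..t} f"
proof -
  let ?C = "critical_points f"
  have C: "0 \<in> ?C" "1 \<in> ?C" "?C \<subseteq> {0..1}"
    by (auto simp: critical_points_def turning_point_def)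
  define s where "s = Max {c \<in> ?C. c \<le> r}"
  define t where "t = Min {c \<in> ?C. r \<le> c}"
  have "{c \<in> ?C. c \<le> r} \<noteq> {}" "{c \<in> ?C. r \<le> c} \<noteq> {}" using C assms by auto
  then have s: "s \<in> ?C" "s \<le> r" and t: "t \<in> ?C" "r \<le> t"
    using Max_in[of "{c \<in> ?C. c \<le> r}"] Min_in[of "{c \<in> ?C. r \<le> c}"] fin
    unfolding s_def t_def by auto
  have "c \<le> s \<or> t \<le> c" if "c \<in> ?C" for c
    using that fin by (cases "c \<le> r") (auto simp: s_def t_def)
  then have cc: "?C \<inter> {s<..<t} = {}" by fastforce
  have st: "s < r" "r < t" using s t assms by (metis less_eq_real_def)+
  have bounds: "0 \<le> s" "t \<le> 1" using s t C by auto
  have cont': "continuous_on {s..t} f"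
    using continuous_on_subset[OF cont] bounds by auto
  have "mono_on {s..t} f" if nd: "\<not> increasing_at (\<lambda>t. - f t) r"
  proof (rule mono_on_if_not_decreasing_at[OF cont' bounds cc])
    show "\<not> increasing_at (\<lambda>t. - f t) u" if "u \<in> {s<..<t}" for u
      using increasing_at_propagate[OF bounds _ that, of "\<lambda>t. - f t" r] cc st nd
      by (auto simp: critical_points_uminus)
  qed
  moreover have "strict_mono_on {s..t} f" if "increasing_at f r"
  proof (rule strict_mono_on_if_increasing_at[OF cont'])
    show "increasing_at f u" if "u \<in> {s<..<t}" for u
      using increasing_at_propagate[OF bounds cc _ \<open>increasing_at f r\<close> that] st by auto
  qed (use bounds in auto)
  ultimately show thesis
    using s t cc st bounds by (intro that) (auto simp: consecutive_critical_def)
qed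

text \<open>Zigzags are bounded by critical points, but the intervals considered later have
  arbitrary ends. A minimum at \<open>a\<close> excludes a descent there, so if \<open>a\<close> is
  regular, the branch through it is nondecreasing and its left end can replace
  \<open>a\<close>.\<close>

lemma critical_point_below:
  assumes fin: "finite (critical_points f)" and cont: "continuous_on {0..1} f"
    and "0 \<le> a" "a < e" "e \<le> 1" and min: "\<And>u. u \<in> {a..e} \<Longrightarrow> f a \<le> f u"
  obtains a' where "a' \<in> critical_points f" "0 \<le> a'" "a' \<le> a"
    "\<And>u. u \<in> {a'..a} \<Longrightarrow> f a' \<le> f u \<and> f u \<le> f a"
proof (cases "a \<in> critical_points f")
  case True
  then show thesis using that[of a] assms by auto
next
  case False
  have "\<not> increasing_at (\<lambda>t. - f t) a"
  proof
    assume "increasing_at (\<lambda>t. - f t) a"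
    then obtain u where "a < u" "u < e" "- f a < - f u"
      using increasing_at_right[of "\<lambda>t. - f t" a e] assms(3-5) by auto
    then show False using min[of u] by auto
  qed
  moreover obtain s t where "consecutive_critical f s t" "0 \<le> s" "s < a" "a < t"
    "\<not> increasing_at (\<lambda>t. - f t) a \<Longrightarrow> mono_on {s..t} f"
    by (rule regular_point_branch[OF fin cont _ False]) (use assms(3-5) in auto)
  ultimately show thesis
    by (intro that[of s]) (auto simp: monotone_on_def consecutive_critical_def)
qed

text \<open>The counterpart at the other end: a regular maximum \<open>e\<close> can be replaced by
  the right end of its branch.\<close>

lemma critical_point_above:
  assumes fin: "finite (critical_points f)" and cont: "continuous_on {0..1} f"
    and "0 \<le> a" "a < e" "e \<le> 1" and max: "\<And>u. u \<in> {a..e} \<Longrightarrow> f u \<le> f e"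
  obtains e' where "e' \<in> critical_points f" "e \<le> e'" "e' \<le> 1"
    "\<And>u. u \<in> {e..e'} \<Longrightarrow> f e \<le> f u \<and> f u \<le> f e'"
proof (cases "e \<in> critical_points f")
  case True
  then show thesis using that[of e] assms by auto
next
  case False
  have "\<not> increasing_at (\<lambda>t. - f t) e"
  proof
    assume "increasing_at (\<lambda>t. - f t) e"
    then obtain u where "a < u" "u < e" "- f u < - f e"
      using increasing_at_left[of "\<lambda>t. - f t" e a] assms(3-5) by auto
    then show False using max[of u] by auto
  qed
  moreover obtain s t where "consecutive_critical f s t" "s < e" "e < t" "t \<le> 1"
    "\<not> increasing_at (\<lambda>t. - f t) e \<Longrightarrow> mono_on {s..t} f"
    by (rule regular_point_branch[OF fin cont _ False]) (use assms(3-5) in auto)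
  ultimately show thesis
    by (intro that[of t]) (auto simp: monotone_on_def consecutive_critical_def)
qed

text \<open>The last passage of \<open>f\<close> through a level that is not a critical value is a descent.\<close>

lemma decreasing_point_between:
  assumes fin: "finite (critical_points f)" and cont: "continuous_on {0..1} f"
    and "0 \<le> p" "p < q" "q \<le> 1" "f q < f p"
  obtains r where "p < r" "r < q" "r \<notin> critical_points f" "increasing_at (\<lambda>t. - f t) r"
proof -
  \<comment> \<open>There are only finitely many critical values, so some level \<open>c\<close> in
    between is not critical.\<close>
  have "infinite {f q<..<f p}" using assms by (simp add: infinite_Ioo)
  then have "\<not> {f q<..<f p} \<subseteq> f ` critical_points f"
    using finite_subset finite_imageI[OF fin] by blast
  then obtain c where "c \<in> {f q<..<f p}" and c: "c \<notin> f ` critical_points f"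
    by blast
  then have c: "f q < c" "c < f p" "c \<notin> f ` critical_points f" by auto
  have cont': "continuous_on {p..q} f" using continuous_on_subset[OF cont] assms by auto
  let ?K = "{u \<in> {p..q}. c \<le> f u}"
  have "closed ?K" by (rule continuous_on_closed_Collect_le) (auto intro!: continuous_intros cont')
  moreover have "bounded ?K" by (rule bounded_subset[OF bounded_closed_interval[of p q]]) auto
  ultimately have "compact ?K" unfolding compact_eq_bounded_closed by blast
  moreover have "p \<in> ?K" using c assms by auto
  ultimately obtain r where r: "r \<in> ?K" "\<And>u. u \<in> ?K \<Longrightarrow> u \<le> r"
    using compact_attains_sup[of ?K] by blast
  have "r < q" using r(1) c by (metis (mono_tags, lifting) atLeastAtMost_iff less_eq_real_def
        linorder_not_less mem_Collect_eq)
  have after: "f u < c" if "r < u" "u \<le> q" for u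
    using r(2)[of u] r(1) that by force
  have "\<exists>v\<ge>r. v \<le> q \<and> f v = c"
    by (rule IVT2') (use r c \<open>r < q\<close> continuous_on_subset[OF cont'] in auto)
  then have "f r = c" using after by (metis less_eq_real_def order_less_irrefl)
  then have "r \<notin> critical_points f" "r \<noteq> p" using c by auto
  then have rc: "r \<notin> critical_points f" "r \<in> {0..1}" "p < r" using r(1) assms(3,5) by auto
  \<comment> \<open>All values between \<open>r\<close> and \<open>q\<close> are below
    \<open>c\<close>, so \<open>r\<close> is neither a point of increase nor on a flat
    piece.\<close>
  have "\<not> increasing_at f r"
    using increasing_at_right[of f r q] after \<open>f r = c\<close> \<open>r < q\<close> rc assms by force
  moreover have "\<not> f constant_on (ball r \<epsilon> \<inter> {0..1})" if "\<epsilon> > 0" for \<epsilon>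
  proof
    define u where "u = min q (r + \<epsilon>/2)"
    assume "f constant_on (ball r \<epsilon> \<inter> {0..1})"
    moreover have "u \<in> ball r \<epsilon> \<inter> {0..1}" "r \<in> ball r \<epsilon> \<inter> {0..1}"
      using rc \<open>r < q\<close> assms that by (auto simp: u_def dist_real_def)
    ultimately have "f u = f r" unfolding constant_on_def by metis
    moreover have "f u < c" using after[of u] \<open>r < q\<close> that by (auto simp: u_def)
    ultimately show False using \<open>f r = c\<close> by simp
  qed
  ultimately have "increasing_at (\<lambda>t. - f t) r"
    using regular_point_cases[OF rc(2,1)] by blast
  then show thesis using that rc \<open>r < q\<close> by blast
qed

section \<open>Monotonicity between global extrema\<close>

definition monotone_between_extrema :: "(real \<Rightarrow> real) \<Rightarrow> bool" where
  "monotone_between_extrema f \<longleftrightarrow>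
     (\<forall>a e. 0 \<le> a \<and> e \<le> 1 \<and> (\<forall>u\<in>{a..e}. f a \<le> f u \<and> f u \<le> f e) \<longrightarrow> mono_on {a..e} f)"

text \<open>If monotonicity fails, there is a regular point of descent \<open>r\<close>. The
  decreasing branch \<open>[s, t]\<close> through it lies strictly between \<open>a\<close> and
  \<open>e\<close>, as otherwise \<open>f r\<close> would be below \<open>f a\<close> or above
  \<open>f e\<close>. Widening \<open>[a, e]\<close> to critical ends then exhibits a
  zigzag.\<close>

lemma no_zigzag_monotone_between_extrema:
  assumes fin: "finite (critical_points f)" and cont: "continuous_on {0..1} f"
    and nz: "\<not> has_zigzag f"
  shows "monotone_between_extrema f"
  unfolding monotone_between_extrema_def
proof (intro allI impI, elim conjE, rule ccontr)
  fix a e assume ae: "0 \<le> a" "e \<le> 1" and ext: "\<forall>u\<in>{a..e}. f a \<le> f u \<and> f u \<le> f e"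
    and "\<not> mono_on {a..e} f"
  then obtain p q where "a \<le> p" "p \<le> q" "q \<le> e" "f q < f p"
    by (auto simp: monotone_on_def not_le)
  then have pq: "a \<le> p" "p < q" "q \<le> e" "f q < f p" by (auto simp: less_le)
  obtain r where r: "p < r" "r < q" "r \<notin> critical_points f" "increasing_at (\<lambda>t. - f t) r"
    by (rule decreasing_point_between[OF fin cont, of p q]) (use pq ae in auto)
  obtain s t where st: "consecutive_critical f s t" "0 \<le> s" "s < r" "r < t" "t \<le> 1"
    and anti: "strict_mono_on {s..t} (\<lambda>t. - f t)"
  proof (rule regular_point_branch[of "\<lambda>t. - f t" r])
    show "finite (critical_points (\<lambda>t. - f t))" using fin by (simp add: critical_points_uminus)
    show "continuous_on {0..1} (\<lambda>t. - f t)" by (intro continuous_intros cont)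
  qed (use r ae pq in \<open>auto simp: critical_points_uminus consecutive_critical_def\<close>)
  have dec: "f v < f u" if "s \<le> u" "u < v" "v \<le> t" for u v
    using anti that by (auto simp: monotone_on_def)
  have "a < s"
  proof (rule ccontr)
    assume "\<not> a < s"
    then have "f r < f a" using r pq st by (intro dec) auto
    moreover have "f a \<le> f r" using ext r pq by auto
    ultimately show False by simp
  qed
  have "t < e"
  proof (rule ccontr)
    assume "\<not> t < e"
    then have "f e < f r" using r pq st by (intro dec) auto
    moreover have "f r \<le> f e" using ext r pq by auto
    ultimately show False by simp
  qed
  obtain a' where a': "a' \<in> critical_points f" "0 \<le> a'" "a' \<le> a"
    "\<And>u. u \<in> {a'..a} \<Longrightarrow> f a' \<le> f u \<and> f u \<le> f a"
    by (rule critical_point_below[OF fin cont, of a e]) (use ext ae pq in auto)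
  obtain e' where e': "e' \<in> critical_points f" "e \<le> e'" "e' \<le> 1"
    "\<And>u. u \<in> {e..e'} \<Longrightarrow> f e \<le> f u \<and> f u \<le> f e'"
    by (rule critical_point_above[OF fin cont, of a e]) (use ext ae pq in auto)
  have "f a' \<le> f a" "f e \<le> f e'" "f a \<le> f e"
    using a'(4)[of a] e'(4)[of e] a' e' ext ae pq by auto
  then have "f a' \<le> f u \<and> f u \<le> f e'" if u: "u \<in> {a'..e'}" for u
  proof -
    consider "u \<in> {a'..a}" | "u \<in> {a..e}" | "u \<in> {e..e'}" using u by fastforce
    then show ?thesis
      using a'(4)[of u] e'(4)[of u] ext \<open>f a' \<le> f a\<close> \<open>f e \<le> f e'\<close> \<open>f a \<le> f e\<close>
      by cases fastforce+
  qed
  then have "interval_inside_zigzag f s t"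
    unfolding interval_inside_zigzag_def
    using st(1,3,4) dec[of s t] \<open>a < s\<close> \<open>t < e\<close> a'(1,3) e'(1,2)
    by (intro conjI bexI[of _ a'] bexI[of _ e'] disjI1) auto
  then show False
    using nz st by (auto simp: has_zigzag_def inside_zigzag_def)
qed

section \<open>Monotone exits from a point\<close>

definition exits_right_up :: "(real \<Rightarrow> real) \<Rightarrow> real \<Rightarrow> bool" where
  "exits_right_up f x \<longleftrightarrow> (\<exists>b\<in>{x..1}. mono_on {x..b} f \<and> (\<forall>t\<in>{0..b}. f t \<le> f b))"

text \<open>Let \<open>b\<close> be the first point of \<open>[x, 1]\<close> where \<open>f\<close>
  reaches or passes an extreme value of its restriction to \<open>[0, x]\<close>; \<open>c\<close>
  shows that there is one. Then \<open>f b\<close> is an extremum over \<open>[0, b]\<close> and the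
  opposite extremum is attained in \<open>[0, x]\<close>, so \<open>f\<close> is monotone from there
  to \<open>b\<close>.\<close>

lemma exits_right:
  assumes cont: "continuous_on {0..1} f" and x: "x \<in> {0..1}"
    and "monotone_between_extrema f" "monotone_between_extrema (\<lambda>t. - f t)"
    and c: "c \<in> {x..1}" "(\<forall>u\<in>{0..x}. f u \<le> f c) \<or> (\<forall>u\<in>{0..x}. f c \<le> f u)"
  shows "exits_right_up f x \<or> exits_right_up (\<lambda>t. - f t) x"
proof -
  have contL: "continuous_on {0..x} f" and contR: "continuous_on {x..1} f"
    using continuous_on_subset[OF cont] x by auto
  obtain M where M: "M \<in> {0..x}" "\<And>u. u \<in> {0..x} \<Longrightarrow> f u \<le> f M"
    using continuous_attains_sup[OF _ _ contL] x by force
  obtain m where m: "m \<in> {0..x}" "\<And>u. u \<in> {0..x} \<Longrightarrow> f m \<le> f u"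
    using continuous_attains_inf[OF _ _ contL] x by force
  let ?B = "{t \<in> {x..1}. f M \<le> f t} \<union> {t \<in> {x..1}. f t \<le> f m}"
  have "closed ?B" by (intro closed_Un continuous_on_closed_Collect_le) (auto intro!: continuous_intros contR)
  moreover have "bounded ?B" by (rule bounded_subset[OF bounded_closed_interval[of x 1]]) auto
  ultimately have "compact ?B" unfolding compact_eq_bounded_closed by blast
  moreover have "c \<in> ?B" using c M m by auto
  ultimately obtain b where b: "b \<in> ?B" "\<And>t. t \<in> ?B \<Longrightarrow> b \<le> t"
    using compact_attains_inf[of ?B] by blast
  have before: "f m \<le> f t \<and> f t \<le> f M" if "0 \<le> t" "t < b" for t
    using b(2)[of t] b(1) that M(2)[of t] m(2)[of t] by (cases "t \<le> x") force+
  show ?thesis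
  proof (cases "f M \<le> f b")
    case True
    have "f m \<le> f M" using m M by auto
    have le: "f m \<le> f t \<and> f t \<le> f b" if "0 \<le> t" "t \<le> b" for t
      using before[of t] that True \<open>f m \<le> f M\<close> by (cases "t = b") auto
    then have "mono_on {m..b} f"
      using assms(3) m b x unfolding monotone_between_extrema_def by auto
    then have "mono_on {x..b} f" using m by (auto intro: monotone_on_subset)
    then show ?thesis using le b unfolding exits_right_up_def by force
  next
    case False
    then have fb: "f b \<le> f m" using b by auto
    have "f m \<le> f M" using m M by auto
    have le: "f b \<le> f t \<and> f t \<le> f M" if "0 \<le> t" "t \<le> b" for t
      using before[of t] that fb \<open>f m \<le> f M\<close> by (cases "t = b") auto
    then have "mono_on {M..b} (\<lambda>t. - f t)"
      using assms(4) M b x unfolding monotone_between_extrema_def by auto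
    then have "mono_on {x..b} (\<lambda>t. - f t)" using M by (auto intro: monotone_on_subset)
    then show ?thesis using le b unfolding exits_right_up_def by force
  qed
qed

text \<open>Reversing an interval swaps the places of minimum and maximum, which negation
  undoes.\<close>

lemma monotone_between_extrema_reflect:
  assumes "monotone_between_extrema (\<lambda>t. - f t)"
  shows "monotone_between_extrema (\<lambda>t. f (1 - t))"
  unfolding monotone_between_extrema_def
proof (intro allI impI, elim conjE)
  fix a e :: real assume ae: "0 \<le> a" "e \<le> 1"
    and *: "\<forall>u\<in>{a..e}. f (1 - a) \<le> f (1 - u) \<and> f (1 - u) \<le> f (1 - e)"
  have "f (1 - a) \<le> f u \<and> f u \<le> f (1 - e)" if "u \<in> {1 - e..1 - a}" for u
    using bspec[OF *, of "1 - u"] that by auto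
  then have "mono_on {1 - e..1 - a} (\<lambda>t. - f t)"
    using assms ae unfolding monotone_between_extrema_def by auto
  then show "mono_on {a..e} (\<lambda>t. f (1 - t))"
    by (auto simp: monotone_on_def)
qed

text \<open>If no suitable \<open>c\<close> exists on the right, then \<open>f M\<close>, the
  maximum over \<open>[0, x]\<close>, exceeds all values on \<open>[x, 1]\<close>. After reflection,
  \<open>1 - M\<close> is the point that \<open>exits_right\<close> asks for.\<close>

lemma exits_up_to_symmetry:
  assumes cont: "continuous_on {0..1} f" and x: "x \<in> {0..1}"
    and nz: "monotone_between_extrema f" "monotone_between_extrema (\<lambda>t. - f t)"
  shows "exits_right_up f x \<or> exits_right_up (\<lambda>t. - f t) x \<or>
    exits_right_up (\<lambda>t. f (1 - t)) (1 - x) \<or> exits_right_up (\<lambda>t. - f (1 - t)) (1 - x)"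
proof (cases "\<exists>c\<in>{x..1}. (\<forall>u\<in>{0..x}. f u \<le> f c) \<or> (\<forall>u\<in>{0..x}. f c \<le> f u)")
  case True
  then show ?thesis using exits_right[OF cont x nz] by blast
next
  case False
  have "continuous_on {0..x} f"
    using continuous_on_subset[OF cont] x by auto
  then obtain M where M: "M \<in> {0..x}" "\<And>u. u \<in> {0..x} \<Longrightarrow> f u \<le> f M"
    using continuous_attains_sup[of "{0..x}" f] x by force
  have "f c \<le> f M" if "c \<in> {x..1}" for c
    using False M that by (metis linorder_not_le order_less_imp_le order_trans)
  then have *: "\<forall>u\<in>{0..1 - x}. f (1 - u) \<le> f (1 - (1 - M))" by simp
  have "continuous_on {0..1} (\<lambda>t. f (1 - t))"
    by (rule continuous_on_compose2[OF cont]) (auto intro!: continuous_intros)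
  moreover have "monotone_between_extrema (\<lambda>t. f (1 - t))" "monotone_between_extrema (\<lambda>t. - f (1 - t))"
    using monotone_between_extrema_reflect[of f] monotone_between_extrema_reflect[of "\<lambda>t. - f t"] nz
    by auto
  ultimately show ?thesis
    using exits_right[of "\<lambda>t. f (1 - t)" "1 - x" "1 - M"] * M(1) x by auto
qed

section \<open>Approximation by injective maps of the plane\<close>

lemma piecewise_linear_piece:
  fixes s :: "nat \<Rightarrow> real"
  assumes "s 0 \<le> x" "x \<le> s (Suc n)"
  obtains k where "k \<le> n" "s k \<le> x" "x \<le> s (Suc k)"
  using assms
proof (induction n arbitrary: thesis)
  case 0
  then show ?case by auto
next
  case (Suc n)
  show ?case
  proof (cases "x \<le> s (Suc n)")
    case True
    show ?thesis by (rule Suc.IH[OF _ Suc.prems(2) True]) (rule Suc.prems(1), auto)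
  next
    case False
    then show ?thesis using Suc.prems(1)[of "Suc n"] Suc.prems by auto
  qed
qed

lemma piecewise_linear_finite_critical_points:
  assumes "piecewise_linear f"
  shows "finite (critical_points f)"
proof -
  obtain n s where s: "s (0::nat) = 0" "s (Suc n) = 1"
    "\<And>k. k \<le> n \<Longrightarrow> s k < s (Suc k)"
    "\<And>k. k \<le> n \<Longrightarrow> \<exists>c d. \<forall>x\<in>{s k..s (Suc k)}. f x = c * x + d"
    using assms unfolding piecewise_linear_def by auto
  have "\<not> turning_point f t" if t: "t \<notin> s ` {..Suc n}" "0 < t" "t < 1" for t
  proof -
    obtain k where k: "k \<le> n" "s k \<le> t" "t \<le> s (Suc k)"
      by (rule piecewise_linear_piece[of s t n]) (use s t in auto)
    then have "s k \<in> s ` {..Suc n}" "s (Suc k) \<in> s ` {..Suc n}" by auto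
    then have "s k < t" "t < s (Suc k)" using k t by (metis less_eq_real_def)+
    then have "t \<in> {s k<..<s (Suc k)}" by simp
    then obtain \<epsilon> where \<epsilon>: "\<epsilon> > 0" "ball t \<epsilon> \<subseteq> {s k<..<s (Suc k)}"
      using openE[OF open_greaterThanLessThan] by metis
    obtain c d where "\<And>x. x \<in> {s k..s (Suc k)} \<Longrightarrow> f x = c * x + d" using s(4) k by blast
    then have f: "f x = c * x + d" if "x \<in> ball t \<epsilon> \<inter> {0..1}" for x using that \<epsilon> by force
    have "strict_mono_on (ball t \<epsilon> \<inter> {0..1}) f" if "c > 0"
      using that by (intro strict_mono_onI) (simp add: f del: Int_iff)
    moreover have "strict_antimono_on (ball t \<epsilon> \<inter> {0..1}) f" if "c < 0"
      using that by (intro monotone_onI) (simp add: f del: Int_iff)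
    moreover have "f constant_on (ball t \<epsilon> \<inter> {0..1})" if "c = 0"
      using that f by (auto simp: constant_on_def)
    ultimately have "strict_mono_on (ball t \<epsilon> \<inter> {0..1}) f \<or>
      strict_antimono_on (ball t \<epsilon> \<inter> {0..1}) f \<or> f constant_on (ball t \<epsilon> \<inter> {0..1})"
      by (metis linorder_neqE_linordered_idom)
    then show ?thesis using \<epsilon>(1) unfolding turning_point_def Let_def by blast
  qed
  then have "critical_points f \<subseteq> {0, 1} \<union> s ` {..Suc n}"
    by (auto simp: critical_points_def turning_point_def)
  then show ?thesis by (rule finite_subset) auto
qed

lemma piecewise_linear_lipschitz:
  assumes "piecewise_linear f"
  obtains L where "L-lipschitz_on {0..1} f"
proof -
  obtain n s where s: "s (0::nat) = 0" "s (Suc n) = 1"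
    "\<And>k. k \<le> n \<Longrightarrow> s k < s (Suc k)"
    "\<And>k. k \<le> n \<Longrightarrow> \<exists>c d. \<forall>x\<in>{s k..s (Suc k)}. f x = c * x + d"
    using assms unfolding piecewise_linear_def by auto
  have piece: "\<exists>L. L-lipschitz_on {s k..s (Suc k)} f" if "k \<le> n" for k
  proof -
    obtain c d where cd: "\<And>x. x \<in> {s k..s (Suc k)} \<Longrightarrow> f x = c * x + d"
      using s(4) \<open>k \<le> n\<close> by blast
    have "\<bar>c\<bar>-lipschitz_on {s k..s (Suc k)} f"
      by (rule lipschitz_onI) (auto simp: cd dist_real_def abs_mult[symmetric] algebra_simps)
    then show ?thesis ..
  qed
  have "k \<le> n \<Longrightarrow> s 0 \<le> s k \<and> (\<exists>L. L-lipschitz_on {s 0..s (Suc k)} f)" for k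
  proof (induction k)
    case 0
    then show ?case using piece by auto
  next
    case (Suc k)
    then obtain L L' where L: "L-lipschitz_on {s 0..s (Suc k)} f"
      "L'-lipschitz_on {s (Suc k)..s (Suc (Suc k))} f" "s 0 \<le> s k"
      using piece[OF Suc.prems] by auto
    have "s k < s (Suc k)" "s (Suc k) < s (Suc (Suc k))" using s Suc by auto
    \<comment> \<open>The gluing lemma expects two functions; here both are
      \<open>f\<close>.\<close>
    moreover have "(max L L')-lipschitz_on {s 0..s (Suc (Suc k))} (\<lambda>x. if x \<le> s (Suc k) then f x else f x)"
      by (rule lipschitz_on_concat_max) (use L in auto)
    ultimately show ?case using L s(1) by auto
  qed
  from this[of n] show thesis using that s by auto
qed

section \<open>Injective plane maps close to a given map on a triod\<close>

definition clamp_to :: "real \<Rightarrow> real \<Rightarrow> real \<Rightarrow> real" where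
  "clamp_to a c t = max a (min c t)"

text \<open>Nothing is known about \<open>f\<close> outside its interval; truncating the argument
  gives functions that are continuous on the whole plane.\<close>

lemma continuous_on_clamped:
  assumes "continuous_on {a..c} f" "a \<le> c" "continuous_on S g"
  shows "continuous_on S (\<lambda>p. f (clamp_to a c (g p)))"
  by (rule continuous_on_compose2[OF assms(1)])
    (use assms in \<open>auto simp: clamp_to_def intro!: continuous_intros\<close>)

text \<open>The estimates concern the triod at \<open>x\<close> only, but injectivity is demanded on
  the plane: \<open>G\<close> may move this triod off the next one, and such maps must still compose
  to injections.\<close>

definition near_map :: "(real \<Rightarrow> real) \<Rightarrow> real \<Rightarrow> real \<Rightarrow> (real \<times> real \<Rightarrow> real \<times> real) \<Rightarrow> bool" where
  "near_map f x \<epsilon> G \<longleftrightarrow> continuous_on UNIV G \<and> inj G \<and>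
     (\<forall>t\<in>{0..1}. \<bar>fst (G (t, 0)) - f t\<bar> < \<epsilon> \<and> \<bar>snd (G (t, 0))\<bar> < \<epsilon>) \<and>
     (\<forall>y\<in>{0..1}. \<bar>fst (G (x, y)) - f x\<bar> < \<epsilon> \<and> \<bar>snd (G (x, y)) - y\<bar> < \<epsilon>)"

definition near_embeddable :: "(real \<Rightarrow> real) \<Rightarrow> real \<Rightarrow> bool" where
  "near_embeddable f x \<longleftrightarrow> (\<forall>\<epsilon>>0. \<exists>G. near_map f x \<epsilon> G)"

lemma near_embeddable_uminus:
  assumes "near_embeddable (\<lambda>t. - f t) x"
  shows "near_embeddable f x"
  unfolding near_embeddable_def
proof (intro allI impI)
  fix \<epsilon> :: real assume "\<epsilon> > 0"
  then obtain G where G: "near_map (\<lambda>t. - f t) x \<epsilon> G"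
    using assms by (auto simp: near_embeddable_def)
  then have cont: "continuous_on UNIV G" and inj: "inj G"
    and arc: "\<And>t. t \<in> {0..1} \<Longrightarrow>
      \<bar>fst (G (t, 0)) - - f t\<bar> < \<epsilon> \<and> \<bar>snd (G (t, 0))\<bar> < \<epsilon>"
    and sticker: "\<And>y. y \<in> {0..1} \<Longrightarrow>
      \<bar>fst (G (x, y)) - - f x\<bar> < \<epsilon> \<and> \<bar>snd (G (x, y)) - y\<bar> < \<epsilon>"
    by (simp_all add: near_map_def)
  have abs_eq: "\<bar>- a - b\<bar> = \<bar>a - - b\<bar>" for a b :: real by simp
  have "near_map f x \<epsilon> (\<lambda>p. (- fst (G p), snd (G p)))"
    unfolding near_map_def fst_conv snd_conv abs_eq
  proof (intro conjI ballI)
    show "continuous_on UNIV (\<lambda>p. (- fst (G p), snd (G p)))"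
      by (intro continuous_intros cont)
    show "inj (\<lambda>p. (- fst (G p), snd (G p)))"
    proof (rule injI)
      fix p q assume "(- fst (G p), snd (G p)) = (- fst (G q), snd (G q))"
      then have "G p = G q" by (simp add: prod_eq_iff)
      then show "p = q" by (rule injD[OF inj])
    qed
  qed (use arc sticker in blast)+
  then show "\<exists>G. near_map f x \<epsilon> G" by blast
qed

lemma near_embeddable_reflect:
  assumes "near_embeddable (\<lambda>t. f (1 - t)) (1 - x)"
  shows "near_embeddable f x"
  unfolding near_embeddable_def
proof (intro allI impI)
  fix \<epsilon> :: real assume "\<epsilon> > 0"
  then obtain G where G: "near_map (\<lambda>t. f (1 - t)) (1 - x) \<epsilon> G"
    using assms by (auto simp: near_embeddable_def)
  then have cont: "continuous_on UNIV G" and inj: "inj G"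
    and arc: "\<And>t. t \<in> {0..1} \<Longrightarrow>
      \<bar>fst (G (t, 0)) - f (1 - t)\<bar> < \<epsilon> \<and> \<bar>snd (G (t, 0))\<bar> < \<epsilon>"
    and sticker: "\<And>y. y \<in> {0..1} \<Longrightarrow>
      \<bar>fst (G (1 - x, y)) - f x\<bar> < \<epsilon> \<and> \<bar>snd (G (1 - x, y)) - y\<bar> < \<epsilon>"
    by (auto simp: near_map_def)
  have "near_map f x \<epsilon> (\<lambda>p. G (1 - fst p, snd p))"
    unfolding near_map_def
  proof (intro conjI ballI)
    show "continuous_on UNIV (\<lambda>p. G (1 - fst p, snd p))"
      by (rule continuous_on_compose2[OF cont]) (auto intro!: continuous_intros)
    show "inj (\<lambda>p. G (1 - fst p, snd p))"
    proof (rule injI)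
      fix p q :: "real \<times> real" assume "G (1 - fst p, snd p) = G (1 - fst q, snd q)"
      then have "(1 - fst p, snd p) = (1 - fst q, snd q)" by (rule injD[OF inj])
      then show "p = q" by (simp add: prod_eq_iff)
    qed
  qed (use arc[of "1 - t" for t] sticker in force)+
  then show "\<exists>G. near_map f x \<epsilon> G" by blast
qed

text \<open>The plane is sheared by a tent whose roof is horizontal over \<open>[x, b]\<close> and falls steeply
  right of \<open>b\<close>; then each horizontal line is mapped to itself monotonically. At heights in
  \<open>[0, x]\<close> the part left of the tent is placed over \<open>f|[0, x]\<close> and the steep part over
  \<open>f b\<close>, which is possible as \<open>f \<le> f b\<close> on \<open>[0, b]\<close>. The rest of the graph lies
  at negative heights, so nothing is above the point coming from \<open>x\<close>.\<close>

lemma near_embeddable_exits_right_up: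
  assumes lip: "L-lipschitz_on {0..1} f" and x: "0 \<le> x" and b: "x \<le> b" "b \<le> 1"
    and mono: "mono_on {x..b} f" and max: "\<And>t. t \<in> {0..b} \<Longrightarrow> f t \<le> f b"
  shows "near_embeddable f x"
  unfolding near_embeddable_def
proof (intro allI impI)
  fix \<epsilon> :: real assume "\<epsilon> > 0"
  have "0 \<le> L" and L: "\<And>s t. s \<in> {0..1} \<Longrightarrow> t \<in> {0..1} \<Longrightarrow> \<bar>f s - f t\<bar> \<le> L * \<bar>s - t\<bar>"
    using lip by (auto simp: lipschitz_on_def dist_real_def)
  have cont: "continuous_on {0..1} f" using lip by (rule lipschitz_on_continuous_on)
  \<comment> \<open>The error of \<open>F\<close> and the slant \<open>\<delta> * fst p\<close> cost
    at most \<open>\<delta>\<close> each.\<close>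
  define \<delta> where "\<delta> = \<epsilon> / 3"
  have "\<delta> > 0" using \<open>\<epsilon> > 0\<close> by (simp add: \<delta>_def)
  have \<epsilon>_eq: "\<epsilon> = 3 * \<delta>" by (simp add: \<delta>_def)
  \<comment> \<open>The steep part has parameter length at most \<open>2 / K\<close>, over which
    \<open>f\<close> varies by at most \<open>\<delta>\<close>.\<close>
  define K where "K = 2 + 2 * L / \<delta>"
  have "K > 0" "2 \<le> K" using \<open>0 \<le> L\<close> \<open>\<delta> > 0\<close> by (auto simp: K_def intro: add_pos_nonneg)
  have KL: "L * (2 / K) \<le> \<delta>"
    using \<open>0 \<le> L\<close> \<open>\<delta> > 0\<close> \<open>K > 0\<close> by (simp add: K_def field_simps)
  \<comment> \<open>The floor \<open>- t\<close> makes the height on the last part of the arc record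
    the parameter, so that \<open>f t\<close> can be read off from the height.\<close>
  define h where "h t = max (- t) (min x t - K * max 0 (t - b))" for t
  \<comment> \<open>At fixed \<open>s\<close> only the \<open>min\<close> depends on
    \<open>t\<close>, and it is nondecreasing. For \<open>s = t\<close> in \<open>[0, x]\<close> the
    bound with slope \<open>L\<close> keeps the value at \<open>f t\<close>; for
    \<open>t \<ge> b\<close> the Lipschitz condition lets it reach \<open>f b\<close>. The last two
    summands cancel unless \<open>s < - b\<close>, where they lead from \<open>f b\<close> to the
    values of \<open>f\<close> on \<open>[b, 1]\<close>.\<close>
  define F where "F t s = max (f (clamp_to 0 x s))
       (min (f (clamp_to x b t)) (f (clamp_to 0 x s) + L * (t - clamp_to 0 x s)))
     + f (clamp_to b 1 (- s)) - f b" for t s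
  \<comment> \<open>Heights up to \<open>x\<close> are compressed, which flattens the arc; above
    \<open>x\<close> the scale is 1, which preserves the attached segment.\<close>
  define \<rho> where "\<rho> s = \<delta> * min s x + max 0 (s - x)" for s
  define G where "G p = (let s = h (fst p) + snd p in (F (fst p) s + \<delta> * fst p, \<rho> s))" for p
  have contx: "continuous_on {0..x} f" "continuous_on {x..b} f" "continuous_on {b..1} f"
    using continuous_on_subset[OF cont] x b by auto
  have conth: "continuous_on S (\<lambda>p. h (g p))" if "continuous_on S g"
    for S :: "(real \<times> real) set" and g
    unfolding h_def by (intro continuous_intros that)
  have contF: "continuous_on S (\<lambda>p. F (g p) (k p))" if "continuous_on S g" "continuous_on S k"
    for S :: "(real \<times> real) set" and g k
    unfolding F_def using that x b
    by (intro continuous_intros continuous_on_clamped contx) (auto simp: clamp_to_def intro!: continuous_intros)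
  have "continuous_on UNIV G"
    unfolding G_def Let_def \<rho>_def by (intro continuous_intros contF conth)
  moreover have "inj G"
  proof (rule injI)
    fix p q assume eq: "G p = G q"
    \<comment> \<open>\<open>\<rho>\<close> determines \<open>s\<close>; at fixed \<open>s\<close>
      the first coordinate is strictly increasing in \<open>fst p\<close> because of the slant; both
      together determine \<open>snd p\<close>.\<close>
    define s where "s = h (fst p) + snd p"
    have "\<rho> u < \<rho> v" if "u < v" for u v
    proof (cases "v \<le> x")
      case True
      then show ?thesis using that \<open>\<delta> > 0\<close> by (auto simp: \<rho>_def)
    next
      case False
      moreover have "\<delta> * min u x \<le> \<delta> * min v x" using that \<open>\<delta> > 0\<close> by (intro mult_left_mono) auto
      ultimately show ?thesis using that by (auto simp: \<rho>_def)
    qed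
    then have "inj \<rho>" by (metis injI linorder_neq_iff)
    then have s: "h (fst q) + snd q = s"
      using eq by (auto simp: G_def Let_def s_def inj_def)
    have "F t s + \<delta> * t < F u s + \<delta> * u" if "t < u" for t u
    proof -
      have "f (clamp_to x b t) \<le> f (clamp_to x b u)"
        using mono that b by (intro mono_onD[OF mono]) (auto simp: clamp_to_def)
      moreover have "L * (t - clamp_to 0 x s) \<le> L * (u - clamp_to 0 x s)"
        using that \<open>0 \<le> L\<close> by (intro mult_left_mono) auto
      ultimately have "F t s \<le> F u s" unfolding F_def by linarith
      moreover have "\<delta> * t < \<delta> * u" using that \<open>\<delta> > 0\<close> by simp
      ultimately show ?thesis by linarith
    qed
    moreover have "F (fst p) s + \<delta> * fst p = F (fst q) s + \<delta> * fst q"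
      using eq s by (auto simp: G_def Let_def s_def)
    ultimately have "fst p = fst q" by (metis linorder_neq_iff)
    then show "p = q" using s s_def by (simp add: prod_eq_iff)
  qed
  moreover have "\<bar>fst (G (t, 0)) - f t\<bar> < \<epsilon> \<and> \<bar>snd (G (t, 0))\<bar> < \<epsilon>" if t: "t \<in> {0..1}" for t
  proof -
    have "0 \<le> K * max 0 (t - b)" using \<open>K > 0\<close> by simp
    then have hx: "h t \<le> x" "- t \<le> h t" using t x by (auto simp: h_def)
    have "\<bar>F t (h t) - f t\<bar> \<le> \<delta>"
    proof -
      consider "t \<le> x" | "x \<le> t" "t \<le> b" | "b \<le> t" by linarith
      then show ?thesis
      proof cases
        case 1
        then have "h t = t" using t x b by (auto simp: h_def)
        then show ?thesis using 1 t x b \<open>\<delta> > 0\<close> by (auto simp: F_def clamp_to_def)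
      next
        case 2
        then have "h t = x" using t x b by (auto simp: h_def)
        moreover have "f x \<le> f t" using mono_onD[OF mono, of x t] 2 b by auto
        moreover have "f t \<le> f x + L * (t - x)" using L[of t x] 2 t x b by auto
        ultimately show ?thesis using 2 t x b \<open>\<delta> > 0\<close> by (auto simp: F_def clamp_to_def)
      next
        case 3
        define s' where "s' = clamp_to 0 x (h t)"
        define v where "v = clamp_to b 1 (- h t)"
        have s': "0 \<le> s'" "s' \<le> x" using x by (auto simp: s'_def clamp_to_def)
        have "f s' \<le> f b" using s' b max by auto
        \<comment> \<open>Hence the maximum in \<open>F\<close> equals \<open>f b\<close> and
          cancels, leaving \<open>f v\<close>.\<close>
        moreover have "f b \<le> f s' + L * (t - s')"
        proof -
          have "f b \<le> f s' + L * (b - s')" using L[of b s'] s' b x by auto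
          also have "\<dots> \<le> f s' + L * (t - s')"
            using 3 \<open>0 \<le> L\<close> by (intro add_left_mono mult_left_mono) auto
          finally show ?thesis .
        qed
        moreover have "clamp_to x b t = b" using 3 b by (auto simp: clamp_to_def)
        ultimately have "F t (h t) = f v" by (auto simp: F_def s'_def v_def)
        moreover have v: "b \<le> v" "v \<le> t" "v \<le> 1"
          using hx 3 t b by (auto simp: v_def clamp_to_def)
        moreover have "t - v \<le> 2 / K"
        proof (cases "h t = - t")
          case True
          then show ?thesis using 3 t b \<open>K > 0\<close> by (auto simp: v_def clamp_to_def)
        next
          case False
          \<comment> \<open>The arc is still falling at \<open>t\<close>, and its total drop is at
            most \<open>x + t \<le> 2\<close>.\<close>
          then have "- t < x - K * (t - b)" using 3 t b by (auto simp: h_def max_def split: if_splits)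
          then have "K * (t - b) \<le> 2" using t x b unfolding atLeastAtMost_iff by linarith
          then have "t - b \<le> 2 / K" using \<open>K > 0\<close> by (simp add: field_simps)
          then show ?thesis using v by linarith
        qed
        ultimately have "\<bar>F t (h t) - f t\<bar> \<le> L * (2 / K)"
          using L[of v t] t x b \<open>0 \<le> L\<close> mult_left_mono[of "t - v" "2 / K" L] by auto
        then show ?thesis using KL by linarith
      qed
    qed
    moreover have "\<bar>\<delta> * t\<bar> \<le> \<delta>" using t \<open>\<delta> > 0\<close> by (auto simp: abs_mult)
    moreover have "\<bar>\<delta> * h t\<bar> \<le> \<delta>"
      using hx t x b \<open>\<delta> > 0\<close> by (auto simp: abs_mult abs_le_iff)
    ultimately show ?thesis
      using hx \<open>\<delta> > 0\<close> unfolding G_def Let_def \<rho>_def by (simp add: \<epsilon>_eq)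
  qed
  moreover have "\<bar>fst (G (x, y)) - f x\<bar> < \<epsilon> \<and> \<bar>snd (G (x, y)) - y\<bar> < \<epsilon>" if y: "y \<in> {0..1}" for y
  proof -
    have "h x = x" using x b by (auto simp: h_def)
    moreover have "F x (x + y) = f x" using x b y by (auto simp: F_def clamp_to_def)
    moreover have "\<rho> (x + y) = \<delta> * x + y" using y by (auto simp: \<rho>_def)
    moreover have "\<bar>\<delta> * x\<bar> \<le> \<delta>" using x b \<open>\<delta> > 0\<close> by (auto simp: abs_mult)
    ultimately show ?thesis using \<open>\<delta> > 0\<close> unfolding G_def Let_def by (simp add: \<epsilon>_eq)
  qed
  ultimately have "near_map f x \<epsilon> G" by (simp add: near_map_def)
  then show "\<exists>G. near_map f x \<epsilon> G" by blast
qed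

lemma near_embeddable_no_zigzag:
  assumes pl: "piecewise_linear f" and nz: "\<not> has_zigzag f" and x: "x \<in> {0..1}"
  shows "near_embeddable f x"
proof -
  obtain L where L: "L-lipschitz_on {0..1} f" by (rule piecewise_linear_lipschitz[OF pl])
  have cont: "continuous_on {0..1} f" using L by (rule lipschitz_on_continuous_on)
  have fin: "finite (critical_points f)" by (rule piecewise_linear_finite_critical_points[OF pl])
  have up: "near_embeddable g y" if "L-lipschitz_on {0..1} g" "exits_right_up g y" "0 \<le> y" for g y
    using that near_embeddable_exits_right_up[of L g y] by (auto simp: exits_right_up_def)
  have reflect: "L-lipschitz_on {0..1} (\<lambda>t. f (1 - t))"
  proof (rule lipschitz_onI)
    show "dist (f (1 - s)) (f (1 - t)) \<le> L * dist s t" if "s \<in> {0..1}" "t \<in> {0..1}" for s t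
      using lipschitz_onD[OF L, of "1 - s" "1 - t"] that
      by (simp add: dist_real_def abs_minus_commute)
  qed (rule lipschitz_on_nonneg[OF L])
  have neg: "L-lipschitz_on {0..1} (\<lambda>t. - g t)" if "L-lipschitz_on {0..1} g"
    for g :: "real \<Rightarrow> real"
    using that by (simp add: lipschitz_on_def dist_real_def abs_minus_commute)
  have "monotone_between_extrema f"
    by (rule no_zigzag_monotone_between_extrema[OF fin cont nz])
  moreover have "monotone_between_extrema (\<lambda>t. - f t)"
    by (rule no_zigzag_monotone_between_extrema)
      (use fin cont nz in \<open>auto simp: critical_points_uminus has_zigzag_uminus intro: continuous_intros\<close>)
  ultimately consider "exits_right_up f x" | "exits_right_up (\<lambda>t. - f t) x"
    | "exits_right_up (\<lambda>t. f (1 - t)) (1 - x)" | "exits_right_up (\<lambda>t. - f (1 - t)) (1 - x)"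
    using exits_up_to_symmetry[OF cont x] by blast
  then show ?thesis
    using up[OF L] up[OF neg[OF L]] up[OF reflect] up[OF neg[OF reflect]] x
      near_embeddable_uminus[of f x] near_embeddable_reflect[of f x]
      near_embeddable_uminus[of "\<lambda>t. f (1 - t)" "1 - x"]
    by cases auto
qed

section \<open>Embedding the inverse limit\<close>

lemma uniformly_fast_convergence:
  fixes \<phi> :: "nat \<Rightarrow> 'a::topological_space \<Rightarrow> 'b::complete_space"
  assumes e: "\<And>n. 0 < e n" "\<And>n. e (Suc n) \<le> e n / 2"
    and step: "\<And>n s. s \<in> S \<Longrightarrow> dist (\<phi> (Suc n) s) (\<phi> n s) < e n"
    and cont: "\<And>n. continuous_on S (\<phi> n)"
  obtains \<Phi> where "continuous_on S \<Phi>" "\<And>n s. s \<in> S \<Longrightarrow> dist (\<Phi> s) (\<phi> n s) \<le> 2 * e n"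
proof -
  have dist_le: "dist (\<phi> m s) (\<phi> n s) \<le> 2 * e n" if s: "s \<in> S" and "n \<le> m" for s m n
  proof -
    \<comment> \<open>Subtracting \<open>2 * e m\<close> makes the estimate inductive, as
      \<open>2 * e (Suc m) \<le> e m\<close>.\<close>
    have "dist (\<phi> m s) (\<phi> n s) \<le> 2 * e n - 2 * e m"
      using \<open>n \<le> m\<close>
    proof (induction rule: dec_induct)
      case (step m)
      have "dist (\<phi> (Suc m) s) (\<phi> n s) \<le> dist (\<phi> (Suc m) s) (\<phi> m s) + dist (\<phi> m s) (\<phi> n s)"
        by (rule dist_triangle)
      then show ?case using step.IH assms(3)[OF s, of m] e(2)[of m] by linarith
    qed simp
    then show ?thesis using e(1)[of m] by linarith
  qed
  have "e n \<le> e 0 * (1/2) ^ n" for n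
  proof (induction n)
    case (Suc n)
    then show ?case using e(2)[of n] by simp
  qed simp
  moreover have "(\<lambda>n. e 0 * (1/2) ^ n) \<longlonglongrightarrow> 0"
    by (intro tendsto_mult_right_zero LIMSEQ_realpow_zero) auto
  ultimately have e0: "e \<longlonglongrightarrow> 0"
    by (intro real_tendsto_sandwich[OF _ _ tendsto_const, of 0 e]) (auto simp: less_imp_le[OF e(1)])
  have small: "\<exists>N. \<forall>n\<ge>N. 2 * e n < r" if "r > 0" for r
    using order_tendstoD(2)[OF tendsto_mult_right_zero[OF e0, of 2] that]
    by (simp add: eventually_sequentially)
  have lim: "(\<lambda>n. \<phi> n s) \<longlonglongrightarrow> lim (\<lambda>n. \<phi> n s)" if "s \<in> S" for s
  proof -
    have "Cauchy (\<lambda>n. \<phi> n s)"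
    proof (rule CauchyI')
      fix r :: real assume "r > 0"
      then obtain N where N: "\<And>n. N \<le> n \<Longrightarrow> 2 * e n < r" using small by blast
      have "dist (\<phi> m s) (\<phi> n s) < r" if "N \<le> m" "m < n" for m n
        using dist_le[OF \<open>s \<in> S\<close>, of m n] N[of m] that by (simp add: dist_commute)
      then show "\<exists>M. \<forall>m\<ge>M. \<forall>n>m. dist (\<phi> m s) (\<phi> n s) < r" by blast
    qed
    then show ?thesis using Cauchy_convergent convergent_LIMSEQ_iff by blast
  qed
  have close: "dist (lim (\<lambda>n. \<phi> n s)) (\<phi> n s) \<le> 2 * e n" if "s \<in> S" for s n
    by (rule Lim_bounded[OF tendsto_dist[OF lim[OF that] tendsto_const], of n])
      (use dist_le[OF that] in auto)
  have "uniform_limit S \<phi> (\<lambda>s. lim (\<lambda>n. \<phi> n s)) sequentially"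
  proof (rule uniform_limitI)
    fix r :: real assume "r > 0"
    then obtain N where "\<And>n. N \<le> n \<Longrightarrow> 2 * e n < r" using small by blast
    then show "\<forall>\<^sub>F n in sequentially. \<forall>s\<in>S. dist (\<phi> n s) (lim (\<lambda>n. \<phi> n s)) < r"
      using close unfolding eventually_sequentially
      by (metis dist_commute order_le_less_trans)
  qed
  then have "continuous_on S (\<lambda>s. lim (\<lambda>n. \<phi> n s))"
    by (rule uniform_limit_theorem[rotated]) (auto simp: cont)
  then show thesis using close that by blast
qed

section \<open>Plane embeddings along the system of triods\<close>

definition triod :: "real \<Rightarrow> (real \<times> real) set" where
  "triod x = {p \<in> {0..1} \<times> {0..1}. snd p = 0 \<or> fst p = x}"

lemma near_embeddable_approximation:
  fixes \<psi> :: "real \<times> real \<Rightarrow> 'b::metric_space"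
  assumes "continuous_on UNIV \<psi>" "near_embeddable f x" "f ` {0..1} \<subseteq> {0..1}" "\<epsilon> > 0"
  obtains G where "continuous_on UNIV G" "inj G"
    "\<And>p. p \<in> triod x \<Longrightarrow> dist (\<psi> (G p)) (\<psi> (f (fst p), snd p)) < \<epsilon>"
proof -
  \<comment> \<open>The margin 1 around the unit square leaves room for \<open>G p\<close>, whose
    error \<open>\<eta>\<close> is at most 1.\<close>
  let ?K = "{-1..2::real} \<times> {-1..2::real}"
  have "uniformly_continuous_on ?K \<psi>"
    using assms(1) by (intro compact_uniformly_continuous compact_Times) (auto intro: continuous_on_subset)
  then obtain d where d: "d > 0"
    "\<And>p q. p \<in> ?K \<Longrightarrow> q \<in> ?K \<Longrightarrow> dist p q < d \<Longrightarrow> dist (\<psi> p) (\<psi> q) < \<epsilon>"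
    using \<open>\<epsilon> > 0\<close> unfolding uniformly_continuous_on_def by metis
  define \<eta> where "\<eta> = min (d / 2) 1"
  have \<eta>: "\<eta> > 0" "\<eta> \<le> 1" "2 * \<eta> \<le> d" using d by (auto simp: \<eta>_def)
  obtain G where G: "near_map f x \<eta> G" using assms(2) \<eta> by (auto simp: near_embeddable_def)
  have "dist (\<psi> (G p)) (\<psi> (f (fst p), snd p)) < \<epsilon>" if p: "p \<in> triod x" for p
  proof (rule d(2))
    have fp: "f (fst p) \<in> {0..1}" "snd p \<in> {0..1}" using p assms(3) by (auto simp: triod_def)
    have *: "\<bar>fst (G p) - f (fst p)\<bar> < \<eta>" "\<bar>snd (G p) - snd p\<bar> < \<eta>"
      using p G by (auto simp: triod_def near_map_def)
    show "(f (fst p), snd p) \<in> ?K" using fp by auto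
    have "fst (G p) \<in> {-1..2}" "snd (G p) \<in> {-1..2}" using * fp \<eta> by auto
    then show "G p \<in> ?K" by (simp add: mem_Times_iff)
    have "dist (G p) (f (fst p), snd p) \<le> \<bar>fst (G p) - f (fst p)\<bar> + \<bar>snd (G p) - snd p\<bar>"
      unfolding dist_prod_def by (simp add: dist_real_def sqrt_sum_squares_le_sum_abs)
    also have "\<dots> < d" using * \<eta> by linarith
    finally show "dist (G p) (f (fst p), snd p) < d" .
  qed
  then show thesis using G that by (auto simp: near_map_def)
qed

text \<open>On a compact set a continuous injection has a uniformly continuous inverse.\<close>

lemma injective_separation:
  fixes \<psi> :: "'a::heine_borel \<Rightarrow> 'b::metric_space"
  assumes "continuous_on K \<psi>" "inj_on \<psi> K" "compact K" "\<theta> > 0"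
  obtains e where "e > 0" "\<And>p q. p \<in> K \<Longrightarrow> q \<in> K \<Longrightarrow> dist (\<psi> p) (\<psi> q) < e \<Longrightarrow> dist p q < \<theta>"
proof -
  have "continuous_on (\<psi> ` K) (inv_into K \<psi>)"
    by (rule continuous_on_inv) (use assms in auto)
  then have "uniformly_continuous_on (\<psi> ` K) (inv_into K \<psi>)"
    using assms by (intro compact_uniformly_continuous compact_continuous_image)
  then obtain e where "e > 0" and
    e: "\<And>u v. u \<in> \<psi> ` K \<Longrightarrow> v \<in> \<psi> ` K \<Longrightarrow> dist u v < e \<Longrightarrow> dist (inv_into K \<psi> u) (inv_into K \<psi> v) < \<theta>"
    using \<open>\<theta> > 0\<close> unfolding uniformly_continuous_on_def by metis
  have "dist p q < \<theta>" if "p \<in> K" "q \<in> K" "dist (\<psi> p) (\<psi> q) < e" for p q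
    using e[of "\<psi> p" "\<psi> q"] that assms(2) by (simp add: inv_into_f_f)
  with \<open>e > 0\<close> show thesis by (rule that)
qed

text \<open>The map \<open>f n \<times> id\<close> carries the triod at \<open>x n\<close> to the one at \<open>x (n - 1)\<close>.\<close>

lemma embeddings_along_inverse_system:
  fixes f :: "nat \<Rightarrow> real \<Rightarrow> real" and \<theta> :: "nat \<Rightarrow> real"
  assumes near: "\<And>i. i \<ge> 1 \<Longrightarrow> near_embeddable (f i) (x i)"
    and f: "\<And>i. i \<ge> 1 \<Longrightarrow> f i ` {0..1} \<subseteq> {0..1}"
    and \<theta>: "\<And>n. \<theta> n > 0"
  shows "\<exists>(\<psi> :: nat \<Rightarrow> real \<times> real \<Rightarrow> real^2) e.
    (\<forall>n. continuous_on UNIV (\<psi> n) \<and> 0 < e n \<and> e (Suc n) \<le> e n / 2) \<and>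
    (\<forall>n. \<forall>p\<in>{0..1} \<times> {0..1}. \<forall>q\<in>{0..1} \<times> {0..1}.
      dist (\<psi> n p) (\<psi> n q) < 5 * e n \<longrightarrow> dist p q < \<theta> n) \<and>
    (\<forall>n. \<forall>p\<in>triod (x (Suc n)).
      dist (\<psi> (Suc n) p) (\<psi> n (f (Suc n) (fst p), snd p)) < e n)"
proof -
  let ?Q = "{0..1::real} \<times> {0..1::real}"
  \<comment> \<open>The limit will stay within \<open>2 * e n\<close> of the \<open>n\<close>-th
    map, so points with equal limits have images at most \<open>4 * e n\<close> apart, below the
    threshold \<open>5 * e n\<close>.\<close>
  define separates :: "nat \<Rightarrow> (real \<times> real \<Rightarrow> real^2) \<Rightarrow> real \<Rightarrow> bool" where
    "separates n \<psi> e \<longleftrightarrow> (\<forall>p\<in>?Q. \<forall>q\<in>?Q. dist (\<psi> p) (\<psi> q) < 5 * e \<longrightarrow> dist p q < \<theta> n)" for n \<psi> e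
  define good where
    "good n \<sigma> \<longleftrightarrow> continuous_on UNIV (fst \<sigma>) \<and> inj (fst \<sigma>) \<and> snd \<sigma> > 0 \<and> separates n (fst \<sigma>) (snd \<sigma>)"
    for n and \<sigma> :: "(real \<times> real \<Rightarrow> real^2) \<times> real"
  define step where
    "step n \<sigma> \<sigma>' \<longleftrightarrow> snd \<sigma>' \<le> snd \<sigma> / 2 \<and>
      (\<forall>p\<in>triod (x (Suc n)). dist (fst \<sigma>' p) (fst \<sigma> (f (Suc n) (fst p), snd p)) < snd \<sigma>)"
    for n and \<sigma> \<sigma>' :: "(real \<times> real \<Rightarrow> real^2) \<times> real"
  have radius: "\<exists>e>0. e \<le> r \<and> separates n \<psi> e"
    if \<psi>: "continuous_on UNIV \<psi>" "inj \<psi>" and "r > 0" for n \<psi> r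
  proof -
    obtain e where "e > 0"
      "\<And>p q. p \<in> ?Q \<Longrightarrow> q \<in> ?Q \<Longrightarrow> dist (\<psi> p) (\<psi> q) < e \<Longrightarrow> dist p q < \<theta> n"
      by (rule injective_separation[of ?Q \<psi> "\<theta> n"])
        (use \<theta> continuous_on_subset[OF \<psi>(1)] inj_on_subset[OF \<psi>(2)] in \<open>auto intro: compact_Times\<close>)
    then show ?thesis
      using \<open>r > 0\<close> by (intro exI[of _ "min r (e / 5)"]) (auto simp: separates_def)
  qed
  define \<iota> :: "real \<times> real \<Rightarrow> real^2" where "\<iota> p = (\<chi> i. if i = 1 then fst p else snd p)" for p
  have "continuous_on UNIV (\<lambda>p. if i = 1 then fst p else snd p :: real)" for i :: 2
    by (cases "i = 1") (auto intro!: continuous_intros)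
  then have "continuous_on UNIV \<iota>"
    unfolding \<iota>_def by (rule continuous_on_vec_lambda)
  moreover have "inj \<iota>"
    by (auto simp: inj_def \<iota>_def vec_eq_iff forall_2 prod_eq_iff)
  ultimately have "\<exists>\<sigma>. good 0 \<sigma>"
    using radius[of \<iota> 1 0] by (auto simp: good_def)
  moreover have "\<exists>\<sigma>'. good (Suc n) \<sigma>' \<and> step n \<sigma> \<sigma>'" if "good n \<sigma>" for n \<sigma>
  proof -
    obtain G where G: "continuous_on UNIV G" "inj G"
      "\<And>p. p \<in> triod (x (Suc n)) \<Longrightarrow>
        dist (fst \<sigma> (G p)) (fst \<sigma> (f (Suc n) (fst p), snd p)) < snd \<sigma>"
      by (rule near_embeddable_approximation[of "fst \<sigma>" "f (Suc n)" "x (Suc n)" "snd \<sigma>"])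
        (use \<open>good n \<sigma>\<close> near f in \<open>auto simp: good_def\<close>)
    \<comment> \<open>The new approximation is applied first and the old embedding last. The new
      radius can be chosen only now, since it depends on how well the composition separates
      points.\<close>
    have \<psi>: "continuous_on UNIV (fst \<sigma> \<circ> G)" "inj (fst \<sigma> \<circ> G)"
      using \<open>good n \<sigma>\<close> G(2) continuous_on_compose[OF G(1) continuous_on_subset]
      unfolding good_def by (blast intro: inj_compose)+
    obtain e where "e > 0" "e \<le> snd \<sigma> / 2" "separates (Suc n) (fst \<sigma> \<circ> G) e"
      using radius[OF \<psi>, of "snd \<sigma> / 2"] \<open>good n \<sigma>\<close> by (auto simp: good_def)
    then show ?thesis
      using \<psi> G by (intro exI[of _ "(fst \<sigma> \<circ> G, e)"]) (auto simp: good_def step_def)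
  qed
  ultimately obtain \<sigma> where \<sigma>: "\<And>n. good n (\<sigma> n)" "\<And>n. step n (\<sigma> n) (\<sigma> (Suc n))"
    using dependent_nat_choice[of good step] by blast
  then show ?thesis
    by (intro exI[of _ "\<lambda>n. fst (\<sigma> n)"] exI[of _ "\<lambda>n. snd (\<sigma> n)"])
      (simp add: good_def step_def separates_def)
qed

section \<open>Compactness and coordinates of the inverse limit\<close>

lemma inverse_limit_topology_eq:
  "inverse_limit_topology f = top_of_set (inverse_limit f)"
proof -
  have "product_topology (\<lambda>_. top_of_set {0..1}) UNIV = top_of_set (\<Pi>\<^sub>E i\<in>(UNIV::nat set). {0..1::real})"
    by (simp add: subtopology_product_topology[symmetric] euclidean_product_topology)
  moreover have "(\<Pi>\<^sub>E i\<in>UNIV. {0..1}) \<inter> inverse_limit f = inverse_limit f"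
    by (auto simp: inverse_limit_def)
  ultimately show ?thesis
    by (simp add: inverse_limit_topology_def subtopology_subtopology)
qed

text \<open>Clamping turns every bonding condition into an equation between continuous functions on
  the full product, so a closed set is cut out of a compact cube.\<close>

lemma compact_inverse_limit:
  assumes "\<And>i. i \<ge> 1 \<Longrightarrow> continuous_on {0..1} (f i)"
  shows "compact (inverse_limit f)"
proof -
  have "inverse_limit f = (\<Pi>\<^sub>E i\<in>UNIV. {0..1}) \<inter>
      (\<Inter>i\<in>{1..}. {z. f i (clamp_to 0 1 (z i)) = z (i - 1)})"
    by (auto simp: inverse_limit_def clamp_to_def PiE_iff)
  moreover have "compact (\<Pi>\<^sub>E i\<in>(UNIV::nat set). {0..1::real})"
    using compactin_PiE[of "\<lambda>_. euclideanreal" "UNIV::nat set" "\<lambda>_. {0..1}"]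
    by (simp add: euclidean_product_topology)
  moreover have "closed (\<Inter>i\<in>{1..}. {z. f i (clamp_to 0 1 (z i)) = z (i - 1)})"
    using assms by (intro closed_INT ballI closed_Collect_eq continuous_on_clamped) auto
  ultimately show ?thesis by (simp add: compact_Int_closed)
qed

text \<open>Later coordinates control earlier ones, as each bonding map is Lipschitz. The bounds
  \<open>L i \<ge> 1\<close> allow one product for all \<open>k \<le> n\<close>.\<close>

lemma inverse_limit_expansion:
  assumes lip: "\<And>i. i \<ge> 1 \<Longrightarrow> (L i)-lipschitz_on {0..1} (f i)" and L: "\<And>i. L i \<ge> 1"
    and z: "z \<in> inverse_limit f" "w \<in> inverse_limit f" and "k \<le> n"
  shows "\<bar>z k - w k\<bar> \<le> (\<Prod>i<n. L (Suc i)) * \<bar>z n - w n\<bar>"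
  using \<open>k \<le> n\<close>
proof (induction rule: dec_induct)
  case base
  have "1 \<le> (\<Prod>i<k. L (Suc i))" by (intro prod_ge_1) (use L in auto)
  then show ?case using mult_right_mono[of 1 _ "\<bar>z k - w k\<bar>"] by simp
next
  case (step n)
  have "\<bar>z n - w n\<bar> \<le> L (Suc n) * \<bar>z (Suc n) - w (Suc n)\<bar>"
  proof -
    have "f (Suc n) (z (Suc n)) = z n" "f (Suc n) (w (Suc n)) = w n"
      "z (Suc n) \<in> {0..1}" "w (Suc n) \<in> {0..1}"
      using z by (force simp: inverse_limit_def)+
    then show ?thesis
      using lipschitz_onD[OF lip[of "Suc n"]] by (metis dist_real_def le_add1 plus_1_eq_Suc)
  qed
  then have "(\<Prod>i<n. L (Suc i)) * \<bar>z n - w n\<bar> \<le>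
      (\<Prod>i<n. L (Suc i)) * (L (Suc n) * \<bar>z (Suc n) - w (Suc n)\<bar>)"
    by (intro mult_left_mono prod_nonneg) (use L in \<open>auto intro: order_trans[OF zero_le_one]\<close>)
  with step.IH show ?case by (simp add: mult.assoc)
qed

text \<open>The limit \<open>\<Phi>\<close> of the plane maps embeds the inverse limit with an arc
  attached. Its restriction to height 0 is \<open>\<phi>\<close>; its restriction to the attached
  arc witnesses accessibility.\<close>

lemma accessible_embedding:
  fixes f :: "nat \<Rightarrow> real \<Rightarrow> real" and x :: "nat \<Rightarrow> real"
  assumes lip: "\<And>i. i \<ge> 1 \<Longrightarrow> \<exists>L. L-lipschitz_on {0..1} (f i)"
    and f: "\<And>i. i \<ge> 1 \<Longrightarrow> f i ` {0..1} \<subseteq> {0..1}"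
    and near: "\<And>i. i \<ge> 1 \<Longrightarrow> near_embeddable (f i) (x i)"
    and x: "x \<in> inverse_limit f"
  shows "\<exists>\<phi> :: (nat \<Rightarrow> real) \<Rightarrow> real^2.
    embedding_map (inverse_limit_topology f) euclidean \<phi> \<and>
    accessible_point (\<phi> ` inverse_limit f) (\<phi> x)"
proof -
  let ?X = "inverse_limit f"
  have "\<exists>L. L \<ge> 1 \<and> (i \<ge> 1 \<longrightarrow> L-lipschitz_on {0..1} (f i))" for i
    by (metis lip lipschitz_on_le max.cobounded1 max.cobounded2)
  then obtain L where L: "\<And>i. L i \<ge> 1" "\<And>i. i \<ge> 1 \<Longrightarrow> (L i)-lipschitz_on {0..1} (f i)" by metis
  define C where "C n = (\<Prod>i<n. L (Suc i))" for n
  have C: "C n \<ge> 1" for n unfolding C_def by (intro prod_ge_1) (use L in auto)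
  \<comment> \<open>\<open>C n\<close> bounds the expansion from level \<open>n\<close> down, so
    \<open>\<theta> n\<close>-closeness there gives distance at most \<open>(1/2) ^ n\<close> in
    every coordinate up to \<open>n\<close>.\<close>
  define \<theta> where "\<theta> n = (1/2) ^ n / C n" for n
  have \<theta>: "\<theta> n > 0" for n using C[of n] by (simp add: \<theta>_def)
  obtain \<psi> :: "nat \<Rightarrow> real \<times> real \<Rightarrow> real^2" and e where
    cont: "\<And>n. continuous_on UNIV (\<psi> n)" and e: "\<And>n. e n > 0" "\<And>n. e (Suc n) \<le> e n / 2" and
    sep: "\<And>n p q. p \<in> {0..1} \<times> {0..1} \<Longrightarrow> q \<in> {0..1} \<times> {0..1} \<Longrightarrow>
      dist (\<psi> n p) (\<psi> n q) < 5 * e n \<Longrightarrow> dist p q < \<theta> n" and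
    step: "\<And>n p. p \<in> triod (x (Suc n)) \<Longrightarrow>
      dist (\<psi> (Suc n) p) (\<psi> n (f (Suc n) (fst p), snd p)) < e n"
    using embeddings_along_inverse_system[of f x \<theta>, OF near f \<theta>] by blast
  \<comment> \<open>A point of the inverse limit of the triods has the same height \<open>y\<close>
    at all levels, so the pair \<open>(z, y)\<close> stands for the sequence of the points
    \<open>(z n, y)\<close>.\<close>
  define S where "S = {(z, y). z \<in> ?X \<and> y \<in> {0..1::real} \<and> (y = 0 \<or> z = x)}"
  have coord: "z n \<in> {0..1}" "f (Suc n) (z (Suc n)) = z n" if "z \<in> ?X" for z n
    using that by (force simp: inverse_limit_def)+
  obtain \<Phi> where \<Phi>: "continuous_on S \<Phi>"
    "\<And>n s. s \<in> S \<Longrightarrow> dist (\<Phi> s) (\<psi> n (fst s n, snd s)) \<le> 2 * e n"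
  proof (rule uniformly_fast_convergence[of e S "\<lambda>n s. \<psi> n (fst s n, snd s)"])
    fix n
    show "dist (\<psi> (Suc n) (fst s (Suc n), snd s)) (\<psi> n (fst s n, snd s)) < e n" if "s \<in> S" for s
      using step[of "(fst s (Suc n), snd s)" n] that coord by (auto simp: S_def triod_def)
    have "continuous_on S (\<lambda>s. fst s n)"
      by (rule continuous_on_product_then_coordinatewise) (intro continuous_intros)
    then have "continuous_on S (\<lambda>s. (fst s n, snd s))" by (intro continuous_intros)
    then show "continuous_on S (\<lambda>s. \<psi> n (fst s n, snd s))"
      by (rule continuous_on_compose2[OF cont]) auto
  qed (use e in auto)
  have "inj_on \<Phi> S"
  proof (rule inj_onI)
    fix s t assume st: "s \<in> S" "t \<in> S" and eq: "\<Phi> s = \<Phi> t"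
    have X: "fst s \<in> ?X" "fst t \<in> ?X" and y: "snd s \<in> {0..1}" "snd t \<in> {0..1}"
      using st by (auto simp: S_def)
    have close: "dist (fst s n, snd s) (fst t n, snd t) < \<theta> n" for n
    proof (rule sep)
      have "dist (\<psi> n (fst s n, snd s)) (\<psi> n (fst t n, snd t)) \<le>
          dist (\<Phi> s) (\<psi> n (fst s n, snd s)) + dist (\<Phi> t) (\<psi> n (fst t n, snd t))"
        unfolding eq by (metis dist_commute dist_triangle)
      then show "dist (\<psi> n (fst s n, snd s)) (\<psi> n (fst t n, snd t)) < 5 * e n"
        using \<Phi>(2)[OF st(1), of n] \<Phi>(2)[OF st(2), of n] e(1)[of n] by linarith
    qed (use X y coord(1) in auto)
    have zero: "r = 0" if "\<And>n. n \<ge> k \<Longrightarrow> \<bar>r\<bar> \<le> (1/2) ^ n" for r :: real and k :: nat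
    proof -
      have "(\<lambda>n. (1/2::real) ^ n) \<longlonglongrightarrow> 0" by (rule LIMSEQ_realpow_zero) auto
      then have "\<bar>r\<bar> \<le> 0"
        by (rule LIMSEQ_le_const) (use that in auto)
      then show ?thesis by simp
    qed
    have \<theta>_le: "\<theta> n \<le> (1/2) ^ n" for n
      using C[of n] by (simp add: \<theta>_def divide_le_eq mult_le_cancel_left1)
    have "snd s - snd t = 0"
    proof (rule zero[of 0])
      fix n
      have "dist (snd s) (snd t) \<le> dist (fst s n, snd s) (fst t n, snd t)"
        using dist_snd_le[of "(fst s n, snd s)" "(fst t n, snd t)"] by simp
      then show "\<bar>snd s - snd t\<bar> \<le> (1/2) ^ n"
        using close[of n] \<theta>_le[of n] by (simp add: dist_real_def)
    qed
    moreover have "fst s k - fst t k = 0" for k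
    proof (rule zero[of k])
      fix n assume "k \<le> n"
      have "dist (fst s n) (fst t n) \<le> dist (fst s n, snd s) (fst t n, snd t)"
        using dist_fst_le[of "(fst s n, snd s)" "(fst t n, snd t)"] by simp
      then have "\<bar>fst s n - fst t n\<bar> \<le> \<theta> n" using close[of n] by (simp add: dist_real_def)
      then have "C n * \<bar>fst s n - fst t n\<bar> \<le> (1/2) ^ n"
        using C[of n] by (simp add: \<theta>_def le_divide_eq mult.commute)
      then show "\<bar>fst s k - fst t k\<bar> \<le> (1/2) ^ n"
        using inverse_limit_expansion[OF L(2,1) X \<open>k \<le> n\<close>] unfolding C_def by linarith
    qed
    ultimately show "s = t" by (auto simp: prod_eq_iff)
  qed
  define \<phi> where "\<phi> z = \<Phi> (z, 0)" for z
  have XS: "(z, 0) \<in> S" if "z \<in> ?X" for z using that by (auto simp: S_def)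
  have "continuous_on ?X \<phi>"
    unfolding \<phi>_def using XS by (intro continuous_on_compose2[OF \<Phi>(1)]) (auto intro!: continuous_intros)
  moreover have "inj_on \<phi> ?X"
    using \<open>inj_on \<Phi> S\<close> XS by (auto simp: inj_on_def \<phi>_def)
  moreover have "compact ?X"
    by (rule compact_inverse_limit) (use lip lipschitz_on_continuous_on in blast)
  \<comment> \<open>A continuous injection of a compact space into a Hausdorff space is an
    embedding.\<close>
  ultimately have "embedding_map (inverse_limit_topology f) euclidean \<phi>"
    unfolding inverse_limit_topology_eq
    by (intro continuous_imp_embedding_map) (auto simp: compact_space_subtopology)
  moreover have "accessible_point (\<phi> ` ?X) (\<phi> x)"
    unfolding accessible_point_def
  proof (intro conjI exI)
    define g where "g y = \<Phi> (x, y)" for y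
    have xS: "(x, y) \<in> S" if "y \<in> {0..1}" for y using that x by (auto simp: S_def)
    have "path g"
      unfolding path_def g_def using xS
      by (intro continuous_on_compose2[OF \<Phi>(1)]) (auto intro!: continuous_intros)
    moreover have "inj_on g {0..1}"
      using inj_onD[OF \<open>inj_on \<Phi> S\<close> _ xS xS] by (intro inj_onI) (auto simp: g_def)
    ultimately show "arc g" by (simp add: arc_def)
    \<comment> \<open>Injectivity of \<open>\<Phi>\<close> on \<open>S\<close> lets the attached arc
      meet the image of \<open>\<phi>\<close> only at its end.\<close>
    have "g y = \<phi> z \<longleftrightarrow> y = 0 \<and> z = x" if "y \<in> {0..1}" "z \<in> ?X" for y z
      using inj_on_eq_iff[OF \<open>inj_on \<Phi> S\<close> xS[OF that(1)] XS[OF that(2)]]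
      by (auto simp: g_def \<phi>_def)
    then show "path_image g \<inter> \<phi> ` ?X = {\<phi> x}"
      using x by (auto simp: path_image_def g_def \<phi>_def image_iff intro!: bexI[of _ 0])
  qed (use x in auto)
  ultimately show ?thesis by blast
qed

theorem corollary7p4:
  fixes f :: "nat \<Rightarrow> real \<Rightarrow> real" and x :: "nat \<Rightarrow> real"
  assumes "\<And>i. i \<ge> 1 \<Longrightarrow> continuous_on {0..1} (f i)"
    and "\<And>i. i \<ge> 1 \<Longrightarrow> piecewise_linear (f i)"
    and "\<And>i. i \<ge> 1 \<Longrightarrow> f i ` {0..1} = {0..1}"
    and "\<And>i. i \<ge> 1 \<Longrightarrow> \<not> has_zigzag (f i)"
    and "x \<in> inverse_limit f"
  shows "\<exists>\<phi> :: (nat \<Rightarrow> real) \<Rightarrow> real^2.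
           embedding_map (inverse_limit_topology f) euclidean \<phi> \<and>
           accessible_point (\<phi> ` inverse_limit f) (\<phi> x)"
proof (rule accessible_embedding)
  fix i :: nat assume i: "i \<ge> 1"
  show "\<exists>L. L-lipschitz_on {0..1} (f i)"
    by (rule piecewise_linear_lipschitz[OF assms(2)[OF i]]) blast
  show "f i ` {0..1} \<subseteq> {0..1}" using assms(3)[OF i] by simp
  show "near_embeddable (f i) (x i)"
    using near_embeddable_no_zigzag[OF assms(2)[OF i] assms(4)[OF i]] assms(5)
    by (simp add: inverse_limit_def)
qed (rule assms)

end
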